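(* Let $F$ be a reproducing kernel Hilbert space of real functions on a set $D\subset\mathbb{R}^d$ ($d$ a positive integer), let $G$ be a real Hilbert space, and let $S:F\to G$ be a non-zero compact (continuous) linear operator. Let $\lambda_1>0$ be the largest eigenvalue of $S^*S:F\to F$. For $g\in G$ define the continuous linear functional $I_g:F\to\mathbb{R}$ by $I_gf=\langle f,S^*g\rangle_F$ for all $f\in F$. Then: (1) For every $g\in G$ with $\|g\|_G=1$, $$e_n(I_g,\Lambda^{\rm std})\le e_n(S,\Lambda^{\rm std})\qquad\text{for all } n\in\{0,1,2,\dots\}.$$ (2) For $g\in G$, one has $$e_0(I_g)=e_0(S)\ \text{ and }\ \|g\|_G=1$$ if and only if $g=\lambda_1^{-1/2}S\eta$ for some $\eta\in F$ with $\|\eta\|_F=1$ and $S^*S\eta=\lambda_1\eta$.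
   Context: Let $T:F\to H$ be a continuous linear operator from the reproducing kernel Hilbert space $F$ (of real functions on $D$) into a real Hilbert space $H$; this is applied with $T=S$, $H=G$ and with $T=I_g$, $H=\mathbb{R}$. The standard class of information $\Lambda^{\rm std}$ is the set of all function evaluation functionals $f\mapsto f(t)$, $t\in D$. For $n\ge 1$, the $n$th minimal worst case error is $$e_n(T,\Lambda^{\rm std})=\inf_{L_1,\dots,L_n\in\Lambda^{\rm std},\ g_1,\dots,g_n\in H}\ \sup_{\|f\|_F\le 1}\Big\|Tf-\sum_{j=1}^nL_j(f)\,g_j\Big\|_H,$$ and for $n=0$ (zero algorithm) the initial error is $e_0(T,\Lambda^{\rm std})=e_0(T)=\|T\|_{F\to H}$. In particular $e_0(I_g)=\|S^*g\|_F$ and $e_0(S)=\|S\|_{F\to G}$. *)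

theory Defs
  imports "HOL-Analysis.Analysis"
begin

text \<open>
  A Hilbert space of real functions on a set is given by a Hilbert space type together with an
  evaluation map: \<open>ev f t\<close> is the value at \<open>t\<close> of the function represented by \<open>f\<close>.
  Values of \<open>ev f\<close> outside \<open>D\<close> are irrelevant. Linearity of the functionals says that the vector
  space operations are the pointwise ones, and the second conjunct says that the elements of the
  space are determined by their values on \<open>D\<close>, i.e. that they are functions on \<open>D\<close>.
\<close>

definition rkhs :: "'d set \<Rightarrow> ('f::{real_inner,complete_space} \<Rightarrow> 'd \<Rightarrow> real) \<Rightarrow> bool" where
  "rkhs D ev \<longleftrightarrow>
     (\<forall>t\<in>D. bounded_linear (\<lambda>f. ev f t)) \<and>
     (\<forall>f g. (\<forall>t\<in>D. ev f t = ev g t) \<longrightarrow> f = g)"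

definition std_information :: "'d set \<Rightarrow> ('f \<Rightarrow> 'd \<Rightarrow> real) \<Rightarrow> ('f \<Rightarrow> real) set" where
  "std_information D ev = {(\<lambda>f. ev f t) | t. t \<in> D}"

definition compact_operator :: "('a::real_normed_vector \<Rightarrow> 'b::real_normed_vector) \<Rightarrow> bool" where
  "compact_operator T \<longleftrightarrow>
     bounded_linear T \<and> (\<forall>B. bounded B \<longrightarrow> compact (closure (T ` B)))"

definition eigenvalue :: "('a::real_vector \<Rightarrow> 'a) \<Rightarrow> real \<Rightarrow> bool" where
  "eigenvalue A \<mu> \<longleftrightarrow> (\<exists>x. x \<noteq> 0 \<and> A x = \<mu> *\<^sub>R x)"

text \<open>
  Only meaningful if the set of eigenvalues has a greatest element, which is the case for
  \<open>S\<^sup>*S\<close> with \<open>S\<close> a non-zero compact operator between Hilbert spaces.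
\<close>

definition largest_eigenvalue :: "('a::real_vector \<Rightarrow> 'a) \<Rightarrow> real" where
  "largest_eigenvalue A = (GREATEST \<mu>. eigenvalue A \<mu>)"

definition worst_case_error ::
    "('f::real_normed_vector \<Rightarrow> 'h::real_normed_vector) \<Rightarrow> ('f \<Rightarrow> 'h) \<Rightarrow> real" where
  "worst_case_error T A = (SUP f\<in>{f. norm f \<le> 1}. norm (T f - A f))"

text \<open>
  The infimum and suprema are real-valued. The suprema are over bounded sets when \<open>T\<close> and the
  functionals in \<open>\<Lambda>\<close> are bounded linear, and the infimum is over a set that is bounded below by 0
  and non-empty when \<open>\<Lambda>\<close> is.
\<close>

definition minimal_error ::
    "('f \<Rightarrow> real) set \<Rightarrow> nat \<Rightarrow> ('f::real_normed_vector \<Rightarrow> 'h::real_normed_vector) \<Rightarrow> real" where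
  "minimal_error \<Lambda> n T =
     (if n = 0 then onorm T
      else Inf {worst_case_error T (\<lambda>f. \<Sum>j=1..n. L j f *\<^sub>R g j) | L g. \<forall>j\<in>{1..n}. L j \<in> \<Lambda>})"

definition dual_functional ::
    "('f::real_inner \<Rightarrow> 'g::real_inner) \<Rightarrow> 'g \<Rightarrow> 'f \<Rightarrow> real" where
  "dual_functional S g f = f \<bullet> adjoint S g"

end

theory Submission
  imports Defs
begin

text \<open>
  Part (1): pairing an algorithm for \<open>S\<close> with \<open>g\<close> gives an algorithm for \<open>I\<^sub>g\<close> that uses the same
  function values, and Cauchy-Schwarz bounds its error.
  Part (2): compactness makes \<open>\<parallel>S\<parallel>\<^sup>2\<close> the largest eigenvalue of \<open>S\<^sup>*S\<close>. The equality
  \<open>\<parallel>S\<^sup>*g\<parallel> = \<parallel>S\<parallel>\<close> with \<open>\<parallel>g\<parallel> = 1\<close> forces equality in Cauchy-Schwarz for \<open>\<langle>SS\<^sup>*g, g\<rangle>\<close>, so that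
  \<open>SS\<^sup>*g = \<parallel>S\<parallel>\<^sup>2 g\<close> and \<open>\<eta> = S\<^sup>*g / \<parallel>S\<parallel>\<close> is the required eigenvector.
\<close>

section \<open>Riesz representation and the adjoint of a bounded operator\<close>

text \<open>
  The representing vector minimises \<open>J x = \<parallel>x\<parallel>\<^sup>2 - 2 \<phi> x\<close>; the parallelogram law makes minimising
  sequences Cauchy.
\<close>

theorem riesz_representation:
  fixes \<phi> :: "'a::{real_inner,complete_space} \<Rightarrow> real"
  assumes "bounded_linear \<phi>"
  shows "\<exists>w. \<forall>x. \<phi> x = x \<bullet> w"
proof -
  interpret \<phi>: bounded_linear \<phi> by fact
  define J where "J x = x \<bullet> x - 2 * \<phi> x" for x
  have J_ge: "J x \<ge> - ((onorm \<phi>)\<^sup>2)" for x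
  proof -
    have "\<phi> x \<le> onorm \<phi> * norm x"
      using onorm[OF assms, of x] by simp
    moreover have "0 \<le> (norm x - onorm \<phi>)\<^sup>2" by simp
    ultimately show ?thesis
      by (simp add: J_def dot_square_norm power2_diff mult.commute)
  qed
  define m where "m = Inf (range J)"
  have bdd: "bdd_below (range J)"
    using J_ge by (auto intro!: bdd_belowI)
  have m_le: "m \<le> J x" for x
    unfolding m_def using bdd by (simp add: cInf_lower)
  have "\<exists>x. J x < m + inverse (real (Suc n))" for n
    using cInf_lessD[of "range J" "m + inverse (real (Suc n))"] unfolding m_def by auto
  then obtain X where X: "\<And>n. J (X n) < m + inverse (real (Suc n))"
    by metis
  \<comment> \<open>The terms in \<open>\<phi>\<close> cancel on the right, leaving the ordinary
    parallelogram law.\<close>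
  have parallelogram: "(norm (x - y))\<^sup>2 = 2 * (J x + J y) - 4 * J ((1/2) *\<^sub>R (x + y))" for x y
    unfolding J_def dot_square_norm[symmetric]
    by (simp add: \<phi>.scaleR \<phi>.add inner_diff inner_add inner_commute algebra_simps)
  have "Cauchy X"
  proof (rule CauchyI)
    fix e :: real assume "e > 0"
    \<comment> \<open>Two values of \<open>J\<close> below \<open>m + e\<^sup>2 / 4\<close> and a
      midpoint value of at least \<open>m\<close> make the right side of
      \<open>parallelogram\<close> less than exactly \<open>e\<^sup>2\<close>.\<close>
    then have "e\<^sup>2 / 4 > 0" by simp
    then obtain N where N: "inverse (real (Suc N)) < e\<^sup>2 / 4"
      using reals_Archimedean by blast
    have "norm (X i - X j) < e" if "i \<ge> N" "j \<ge> N" for i j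
    proof -
      have "inverse (real (Suc i)) \<le> inverse (real (Suc N))"
        and "inverse (real (Suc j)) \<le> inverse (real (Suc N))"
        using that by (simp_all add: field_simps)
      with X[of i] X[of j] N have "J (X i) < m + e\<^sup>2 / 4" "J (X j) < m + e\<^sup>2 / 4"
        by linarith+
      with m_le[of "(1/2) *\<^sub>R (X i + X j)"] parallelogram[of "X i" "X j"]
      have "(norm (X i - X j))\<^sup>2 < e\<^sup>2"
        by argo
      with \<open>e > 0\<close> show ?thesis
        by (simp add: power2_less_imp_less)
    qed
    then show "\<exists>M. \<forall>i\<ge>M. \<forall>j\<ge>M. norm (X i - X j) < e" by blast
  qed
  then obtain w where w: "X \<longlonglongrightarrow> w"
    using Cauchy_convergent_iff convergent_def by blast
  have "(\<lambda>n. J (X n)) \<longlonglongrightarrow> J w"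
    unfolding J_def by (intro tendsto_intros \<phi>.tendsto w)
  moreover have "(\<lambda>n. m + inverse (real (Suc n))) \<longlonglongrightarrow> m"
    using LIMSEQ_inverse_real_of_nat_add by simp
  ultimately have "J w \<le> m"
    using X by (intro LIMSEQ_le) (auto intro: less_imp_le)
  then have w_min: "J w \<le> J x" for x
    using m_le[of x] by linarith
  have "\<phi> x = x \<bullet> w" for x
  proof (cases "x = 0")
    case False
    define d where "d = \<phi> x - x \<bullet> w"
    \<comment> \<open>This \<open>t\<close> minimises the quadratic
      \<open>J (w + t *\<^sub>R x)\<close>; its minimum is \<open>J w - t * d\<close>, so minimality
      of \<open>w\<close> forces \<open>d = 0\<close>.\<close>
    define t where "t = d / (x \<bullet> x)"
    have pos: "x \<bullet> x > 0" using False by simp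
    have "J (w + t *\<^sub>R x) = J w + t * (t * (x \<bullet> x) - 2 * d)"
      by (simp add: J_def d_def \<phi>.add \<phi>.scaleR inner_add inner_commute algebra_simps)
    also have "t * (x \<bullet> x) = d"
      using pos by (simp add: t_def)
    finally have "t * d \<le> 0"
      using w_min[of "w + t *\<^sub>R x"] by (simp add: algebra_simps)
    moreover have "t * d = d\<^sup>2 / (x \<bullet> x)"
      by (simp add: t_def power2_eq_square)
    ultimately have "d = 0"
      using pos by (simp add: divide_le_0_iff)
    then show ?thesis by (simp add: d_def)
  qed simp
  then show ?thesis by blast
qed

text \<open>\<open>adjoint\<close> is a choice operator, so its characteristic identity must be
  earned by exhibiting some adjoint map; Riesz representation of
  \<open>\<lambda>x. T x \<bullet> y\<close> provides its value at each \<open>y\<close>.\<close>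

lemma adjoint_inner_right:
  fixes T :: "'a::{real_inner,complete_space} \<Rightarrow> 'b::real_inner"
  assumes "bounded_linear T"
  shows "x \<bullet> adjoint T y = T x \<bullet> y"
proof -
  have "\<exists>w. \<forall>x. T x \<bullet> y = x \<bullet> w" for y
    by (intro riesz_representation bounded_linear_inner_left_comp assms)
  then obtain T' where "\<forall>x y. T x \<bullet> y = x \<bullet> T' y" by metis
  then show ?thesis
    using adjoint_unique by metis
qed

lemma adjoint_scaleR:
  fixes T :: "'a::{real_inner,complete_space} \<Rightarrow> 'b::real_inner"
  assumes "bounded_linear T"
  shows "adjoint T (c *\<^sub>R y) = c *\<^sub>R adjoint T y"
  by (rule vector_eq_ldot[THEN iffD1]) (simp add: adjoint_inner_right[OF assms])

lemma norm_adjoint_le: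
  fixes T :: "'a::{real_inner,complete_space} \<Rightarrow> 'b::real_inner"
  assumes "bounded_linear T"
  shows "norm (adjoint T y) \<le> onorm T * norm y"
proof (cases "adjoint T y = 0")
  case False
  have "(norm (adjoint T y))\<^sup>2 = T (adjoint T y) \<bullet> y"
    by (simp add: adjoint_inner_right[OF assms, symmetric] dot_square_norm)
  also have "\<dots> \<le> norm (T (adjoint T y)) * norm y"
    by (rule norm_cauchy_schwarz)
  also have "\<dots> \<le> (onorm T * norm (adjoint T y)) * norm y"
    by (intro mult_right_mono onorm[OF assms]) simp
  finally show ?thesis
    using False by (simp add: power2_eq_square)
qed (simp add: onorm_pos_le[OF assms])

text \<open>Cauchy-Schwarz gives one bound, evaluation at \<open>v\<close> the other. With
  \<open>v = adjoint S g\<close> this is the initial error of the functional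
  \<open>dual_functional S g\<close>.\<close>

lemma onorm_inner_left: "onorm (\<lambda>x. x \<bullet> v) = norm v"
proof (rule antisym)
  show "onorm (\<lambda>x. x \<bullet> v) \<le> norm v"
    by (rule onorm_bound) (auto simp: mult.commute Cauchy_Schwarz_ineq2)
  have "norm (v \<bullet> v) \<le> onorm (\<lambda>x. x \<bullet> v) * norm v"
    by (rule onorm) (rule bounded_linear_inner_left)
  then show "norm v \<le> onorm (\<lambda>x. x \<bullet> v)"
    by (cases "v = 0") (simp_all add: dot_square_norm power2_eq_square
        onorm_pos_le bounded_linear_inner_left)
qed

section \<open>Compactness and the largest eigenvalue\<close>

text \<open>
  Expanding the square of the norm shows that equality in the Cauchy-Schwarz inequality forces
  proportionality, with an error term for use with approximate maximisers.
\<close>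

lemma norm_diff_scaleR_square_le:
  fixes u x :: "'a::real_inner"
  assumes "norm u \<le> s * r" and "norm x \<le> 1" and "u \<bullet> x = r\<^sup>2" and "0 \<le> s" and "0 \<le> r"
  shows "(norm (u - s\<^sup>2 *\<^sub>R x))\<^sup>2 \<le> s\<^sup>2 * (s\<^sup>2 - r\<^sup>2)"
proof -
  have "(norm (u - s\<^sup>2 *\<^sub>R x))\<^sup>2 = (norm u)\<^sup>2 - 2 * s\<^sup>2 * r\<^sup>2 + s^4 * (norm x)\<^sup>2"
    using assms(3) unfolding dot_square_norm[symmetric]
    by (simp add: inner_diff inner_commute power_numeral_reduce algebra_simps)
  moreover have "(norm u)\<^sup>2 \<le> (s * r)\<^sup>2"
    using assms(1) by (intro power_mono) auto
  moreover have "s^4 * (norm x)\<^sup>2 \<le> s^4 * 1"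
    using assms(2) by (intro mult_left_mono) (auto simp: power_le_one)
  ultimately show ?thesis
    by (simp add: power_mult_distrib power_numeral_reduce algebra_simps)
qed

text \<open>The norm attains its maximum on the compact closure of the image of the unit ball, and
  that maximum is the operator norm. The maximiser is only known to lie in the closure, hence a
  sequence instead of a single maximising vector.\<close>

lemma compact_operator_limit_of_norm:
  fixes S :: "'a::real_normed_vector \<Rightarrow> 'b::real_normed_vector"
  assumes "compact_operator S"
  shows "\<exists>x y. (\<forall>n. norm (x n) \<le> 1) \<and> (\<lambda>n. S (x n)) \<longlonglongrightarrow> y \<and> norm y = onorm S"
proof -
  interpret S: bounded_linear S
    using assms by (simp add: compact_operator_def)
  let ?K = "closure (S ` cball 0 1)"
  have "compact ?K"
    using assms by (simp add: compact_operator_def)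
  moreover have "?K \<noteq> {}" by simp
  ultimately have "\<exists>y\<in>?K. \<forall>z\<in>?K. norm z \<le> norm y"
    by (rule continuous_attains_sup) (rule continuous_on_norm_id)
  then obtain y where y: "y \<in> ?K" "\<And>z. z \<in> ?K \<Longrightarrow> norm z \<le> norm y"
    by blast
  from y(1) obtain u where u: "\<And>n. u n \<in> S ` cball 0 1" and lim: "u \<longlonglongrightarrow> y"
    unfolding closure_sequential by blast
  have "\<exists>x. norm x \<le> 1 \<and> u n = S x" for n using u[of n] by auto
  then obtain x where x: "\<And>n. norm (x n) \<le> 1" "\<And>n. u n = S (x n)" by metis
  have "norm y \<le> onorm S"
  proof (rule Lim_norm_ubound[OF _ lim])
    have "norm (u n) \<le> onorm S" for n
      using onorm[OF S.bounded_linear_axioms, of "x n"]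
        mult_left_mono[OF x(1)[of n] onorm_pos_le[OF S.bounded_linear_axioms]]
      unfolding x(2) by linarith
    then show "eventually (\<lambda>n. norm (u n) \<le> onorm S) sequentially" by simp
  qed simp
  moreover have "onorm S \<le> norm y"
  proof (rule onorm_bound)
    fix v
    show "norm (S v) \<le> norm y * norm v"
    proof (cases "v = 0")
      case False
      have "(1 / norm v) *\<^sub>R v \<in> cball 0 1"
        using False by simp
      then have "S ((1 / norm v) *\<^sub>R v) \<in> ?K"
        by (intro subsetD[OF closure_subset] imageI)
      then have "norm (S ((1 / norm v) *\<^sub>R v)) \<le> norm y"
        by (rule y(2))
      then show ?thesis
        using False by (simp add: S.scaleR divide_le_eq)
    qed (simp add: S.zero)
  qed simp
  ultimately have "norm y = onorm S" by (rule antisym)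
  moreover have "u = (\<lambda>n. S (x n))"
    by (rule ext) (rule x(2))
  with lim have "(\<lambda>n. S (x n)) \<longlonglongrightarrow> y" by simp
  ultimately show ?thesis
    using x(1) by (intro exI[of _ x] exI[of _ y] conjI allI)
qed

text \<open>A sequence with \<open>S (x n)\<close> tending to a \<open>y\<close> of norm
  \<open>onorm S\<close> consists of approximate eigenvectors. Passing to the limit gives
  \<open>S (adjoint S y) = s\<^sup>2 *\<^sub>R y\<close>, so \<open>adjoint S y\<close> is an exact
  eigenvector.\<close>

lemma eigenvalue_adjoint_comp_onorm_square:
  fixes S :: "'a::{real_inner,complete_space} \<Rightarrow> 'b::real_inner"
  assumes "compact_operator S" and "S \<noteq> (\<lambda>f. 0)"
  shows "eigenvalue (adjoint S \<circ> S) ((onorm S)\<^sup>2)"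
proof -
  have bl: "bounded_linear S"
    using assms by (simp add: compact_operator_def)
  then interpret S: bounded_linear S .
  define s where "s = onorm S"
  have s: "s > 0"
    using onorm_pos_lt[OF bl] assms(2) by (auto simp: s_def)
  obtain x y where x: "\<And>n. norm (x n) \<le> 1" and lim: "(\<lambda>n. S (x n)) \<longlonglongrightarrow> y" and y: "norm y = s"
    using compact_operator_limit_of_norm[OF assms(1)] unfolding s_def by blast
  have adj_diff: "adjoint S a - adjoint S b = adjoint S (a - b)" for a b
    by (rule vector_eq_ldot[THEN iffD1]) (simp add: adjoint_inner_right[OF bl] inner_diff_right)
  \<comment> \<open>The near-equality estimate with \<open>r = norm (S (x n))\<close>; the right
    side vanishes in the limit because \<open>r\<close> tends to \<open>s\<close>.\<close>
  have bound: "norm (adjoint S (S (x n)) - s\<^sup>2 *\<^sub>R x n) \<le> sqrt (s\<^sup>2 * (s\<^sup>2 - (norm (S (x n)))\<^sup>2))" for n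
  proof (rule real_le_rsqrt, rule norm_diff_scaleR_square_le)
    show "norm (adjoint S (S (x n))) \<le> s * norm (S (x n))"
      using norm_adjoint_le[OF bl] by (simp add: s_def)
    show "adjoint S (S (x n)) \<bullet> x n = (norm (S (x n)))\<^sup>2"
      by (simp add: inner_commute[of _ "x n"] adjoint_inner_right[OF bl] dot_square_norm)
  qed (use x s in auto)
  have "(\<lambda>n. sqrt (s\<^sup>2 * (s\<^sup>2 - (norm (S (x n)))\<^sup>2))) \<longlonglongrightarrow> sqrt (s\<^sup>2 * (s\<^sup>2 - (norm y)\<^sup>2))"
    by (intro tendsto_intros lim)
  then have "(\<lambda>n. sqrt (s\<^sup>2 * (s\<^sup>2 - (norm (S (x n)))\<^sup>2))) \<longlonglongrightarrow> 0"
    by (simp add: y)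
  then have 1: "(\<lambda>n. adjoint S (S (x n)) - s\<^sup>2 *\<^sub>R x n) \<longlonglongrightarrow> 0"
    by (rule Lim_null_comparison[rotated]) (simp add: bound)
  have "(\<lambda>n. s * norm (S (x n) - y)) \<longlonglongrightarrow> s * norm (y - y)"
    by (intro tendsto_intros lim)
  then have "(\<lambda>n. s * norm (S (x n) - y)) \<longlonglongrightarrow> 0"
    by simp
  then have "(\<lambda>n. adjoint S (S (x n)) - adjoint S y) \<longlonglongrightarrow> 0"
    by (rule Lim_null_comparison[rotated]) (simp add: adj_diff s_def norm_adjoint_le[OF bl])
  \<comment> \<open>Both sequences contain \<open>adjoint S (S (x n))\<close>. Its cancellation
    shows that \<open>x n\<close> itself converges after scaling, although only
    \<open>S (x n)\<close> was known to.\<close>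
  from tendsto_diff[OF this 1] have "(\<lambda>n. s\<^sup>2 *\<^sub>R x n - adjoint S y) \<longlonglongrightarrow> 0"
    by simp
  then have "(\<lambda>n. s\<^sup>2 *\<^sub>R x n) \<longlonglongrightarrow> adjoint S y"
    by (simp add: LIM_zero_iff)
  from S.tendsto[OF this] have "(\<lambda>n. s\<^sup>2 *\<^sub>R S (x n)) \<longlonglongrightarrow> S (adjoint S y)"
    by (simp add: S.scaleR)
  moreover have "(\<lambda>n. s\<^sup>2 *\<^sub>R S (x n)) \<longlonglongrightarrow> s\<^sup>2 *\<^sub>R y"
    by (intro tendsto_intros lim)
  ultimately have Sy: "S (adjoint S y) = s\<^sup>2 *\<^sub>R y"
    by (rule LIMSEQ_unique)
  have "adjoint S y \<noteq> 0"
    using Sy y s by (auto simp: S.zero)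
  moreover have "(adjoint S \<circ> S) (adjoint S y) = s\<^sup>2 *\<^sub>R adjoint S y"
    by (simp add: Sy adjoint_scaleR[OF bl])
  ultimately show ?thesis
    unfolding eigenvalue_def s_def by blast
qed

text \<open>The preceding lemma shows that the value is attained. Pairing an eigenvector equation
  with \<open>x\<close> gives \<open>\<mu> * (norm x)\<^sup>2 = (norm (S x))\<^sup>2\<close>, which
  bounds every eigenvalue.\<close>

lemma largest_eigenvalue_adjoint_comp:
  fixes S :: "'a::{real_inner,complete_space} \<Rightarrow> 'b::real_inner"
  assumes "compact_operator S" and "S \<noteq> (\<lambda>f. 0)"
  shows "largest_eigenvalue (adjoint S \<circ> S) = (onorm S)\<^sup>2"
  unfolding largest_eigenvalue_def
proof (rule Greatest_equality)
  show "eigenvalue (adjoint S \<circ> S) ((onorm S)\<^sup>2)"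
    by (rule eigenvalue_adjoint_comp_onorm_square[OF assms])
  fix \<mu> assume "eigenvalue (adjoint S \<circ> S) \<mu>"
  then obtain x where x: "x \<noteq> 0" "adjoint S (S x) = \<mu> *\<^sub>R x"
    by (auto simp: eigenvalue_def)
  have bl: "bounded_linear S"
    using assms by (simp add: compact_operator_def)
  have "\<mu> * (norm x)\<^sup>2 = x \<bullet> adjoint S (S x)"
    by (simp add: x dot_square_norm)
  also have "\<dots> = (norm (S x))\<^sup>2"
    by (simp add: adjoint_inner_right[OF bl] dot_square_norm)
  also have "\<dots> \<le> (onorm S * norm x)\<^sup>2"
    by (intro power_mono onorm[OF bl]) simp
  finally show "\<mu> \<le> (onorm S)\<^sup>2"
    using x(1) by (simp add: power_mult_distrib)
qed

section \<open>Comparison of the minimal errors\<close>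

text \<open>Real-valued suprema can be compared only over sets known to be bounded; this licenses
  the supremum rules used below.\<close>

lemma worst_case_error_bdd_above:
  assumes "bounded_linear T" and "bounded_linear A"
  shows "bdd_above ((\<lambda>f. norm (T f - A f)) ` {f. norm f \<le> 1})"
proof -
  have bl: "bounded_linear (\<lambda>f. T f - A f)"
    by (intro bounded_linear_sub assms)
  have "norm (T f - A f) \<le> onorm (\<lambda>f. T f - A f)" if "norm f \<le> 1" for f
    using onorm[OF bl, of f] mult_left_mono[OF that onorm_pos_le[OF bl]] by simp
  then show ?thesis by (auto intro!: bdd_aboveI)
qed

lemma worst_case_error_nonneg:
  assumes "bounded_linear T" and "bounded_linear A"
  shows "0 \<le> worst_case_error T A"
  unfolding worst_case_error_def
  by (rule cSUP_upper2[OF worst_case_error_bdd_above[OF assms], of 0]) auto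

lemma bounded_linear_std_algorithm:
  assumes "rkhs D ev" and "\<forall>j\<in>{1..n}. L j \<in> std_information D ev"
  shows "bounded_linear (\<lambda>f. \<Sum>j=1..n. L j f *\<^sub>R g j)"
proof (intro bounded_linear_sum bounded_linear_scaleR_const)
  fix j assume "j \<in> {1..n}"
  with assms(2) have "L j \<in> std_information D ev" by blast
  with assms(1) show "bounded_linear (L j)"
    by (auto simp: std_information_def rkhs_def)
qed

lemma dual_functional_eq:
  fixes S :: "'f::{real_inner,complete_space} \<Rightarrow> 'g::real_inner"
  assumes "bounded_linear S"
  shows "dual_functional S g f = S f \<bullet> g"
  by (simp add: dual_functional_def adjoint_inner_right[OF assms])

lemma minimal_error_zero_dual_functional:
  "minimal_error \<Lambda> 0 (dual_functional S g) = norm (adjoint S g)"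
  using onorm_inner_left[of "adjoint S g"]
  by (simp add: minimal_error_def dual_functional_def[abs_def])

text \<open>For each single \<open>f\<close> the error of the functional is
  \<open>\<bar>(S f - A f) \<bullet> g\<bar>\<close>, so Cauchy-Schwarz with
  \<open>norm g = 1\<close> compares the suprema termwise.\<close>

lemma worst_case_error_dual_functional_le:
  fixes S A :: "'f::{real_inner,complete_space} \<Rightarrow> 'g::real_inner"
  assumes "bounded_linear S" and "bounded_linear A" and "norm g = 1"
  shows "worst_case_error (dual_functional S g) (\<lambda>f. A f \<bullet> g) \<le> worst_case_error S A"
  unfolding worst_case_error_def
proof (rule cSUP_mono)
  show "{f::'f. norm f \<le> 1} \<noteq> {}" by (auto intro: exI[of _ 0])
  show "bdd_above ((\<lambda>f. norm (S f - A f)) ` {f. norm f \<le> 1})"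
    by (rule worst_case_error_bdd_above[OF assms(1,2)])
  fix f :: 'f assume "f \<in> {f. norm f \<le> 1}"
  moreover have "norm (dual_functional S g f - A f \<bullet> g) \<le> norm (S f - A f)"
    using Cauchy_Schwarz_ineq2[of "S f - A f" g] assms(3)
    by (simp add: dual_functional_eq[OF assms(1)] inner_diff_left)
  ultimately show "\<exists>m\<in>{f. norm f \<le> 1}. norm (dual_functional S g f - A f \<bullet> g) \<le> norm (S m - A m)"
    by blast
qed

lemma minimal_error_dual_functional_le:
  fixes S :: "'f::{real_inner,complete_space} \<Rightarrow> 'g::real_inner"
  assumes rkhs: "rkhs D ev" and "D \<noteq> {}" and bl: "bounded_linear S" and g: "norm g = 1"
  shows "minimal_error (std_information D ev) n (dual_functional S g)
           \<le> minimal_error (std_information D ev) n S"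
proof (cases "n = 0")
  case True
  \<comment> \<open>Without information the errors are operator norms, so the claim is
    \<open>norm (adjoint S g) \<le> onorm S\<close>.\<close>
  then show ?thesis
    using norm_adjoint_le[OF bl, of g] g
    by (simp add: minimal_error_zero_dual_functional) (simp add: minimal_error_def)
next
  case False
  define \<Lambda> where "\<Lambda> = std_information D ev"
  define E where "E = {worst_case_error (dual_functional S g) (\<lambda>f. \<Sum>j=1..n. L j f *\<^sub>R c j) | L c.
    \<forall>j\<in>{1..n}. L j \<in> \<Lambda>}"
  have bl_dual: "bounded_linear (dual_functional S g)"
    by (simp add: dual_functional_def[abs_def] bounded_linear_inner_left)
  have bdd: "bdd_below E"
  proof (rule bdd_belowI)
    fix e assume "e \<in> E"
    then obtain L c where L: "\<forall>j\<in>{1..n}. L j \<in> \<Lambda>"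
      and e: "e = worst_case_error (dual_functional S g) (\<lambda>f. \<Sum>j=1..n. L j f *\<^sub>R c j)"
      unfolding E_def by blast
    have "bounded_linear (\<lambda>f. \<Sum>j=1..n. L j f *\<^sub>R c j)"
      using bounded_linear_std_algorithm[OF rkhs] L unfolding \<Lambda>_def by blast
    then show "0 \<le> e"
      unfolding e by (rule worst_case_error_nonneg[OF bl_dual])
  qed
  have "Inf E \<le> Inf {worst_case_error S (\<lambda>f. \<Sum>j=1..n. L j f *\<^sub>R h j) | L h. \<forall>j\<in>{1..n}. L j \<in> \<Lambda>}"
  proof (rule cInf_greatest)
    \<comment> \<open>A real infimum is bounded below by its members' lower bounds only if there are
      members; repeating one evaluation \<open>n\<close> times supplies one.\<close>
    obtain l where "l \<in> \<Lambda>"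
      using \<open>D \<noteq> {}\<close> by (auto simp: \<Lambda>_def std_information_def)
    then have "\<exists>L. \<forall>j\<in>{1..n}. L j \<in> \<Lambda>"
      by (intro exI[of _ "\<lambda>_. l"]) simp
    then show "{worst_case_error S (\<lambda>f. \<Sum>j=1..n. L j f *\<^sub>R h j) | L h. \<forall>j\<in>{1..n}. L j \<in> \<Lambda>} \<noteq> {}"
      by blast
  next
    fix e assume "e \<in> {worst_case_error S (\<lambda>f. \<Sum>j=1..n. L j f *\<^sub>R h j) | L h. \<forall>j\<in>{1..n}. L j \<in> \<Lambda>}"
    then obtain L h where L: "\<forall>j\<in>{1..n}. L j \<in> \<Lambda>"
      and e: "e = worst_case_error S (\<lambda>f. \<Sum>j=1..n. L j f *\<^sub>R h j)"
      by blast
    \<comment> \<open>The same sample points are kept and each weight \<open>h j\<close> becomes the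
      real number \<open>h j \<bullet> g\<close>.\<close>
    have "worst_case_error (dual_functional S g) (\<lambda>f. \<Sum>j=1..n. L j f *\<^sub>R (h j \<bullet> g)) \<in> E"
      unfolding E_def using L by (intro CollectI exI[of _ L] exI[of _ "\<lambda>j. h j \<bullet> g"] conjI refl)
    then have "Inf E \<le> worst_case_error (dual_functional S g) (\<lambda>f. \<Sum>j=1..n. L j f *\<^sub>R (h j \<bullet> g))"
      using bdd by (rule cInf_lower)
    also have "\<dots> \<le> e"
      using worst_case_error_dual_functional_le[OF bl bounded_linear_std_algorithm[OF rkhs] g, of n L h] L
      by (simp add: e \<Lambda>_def inner_sum_left)
    finally show "Inf E \<le> e" .
  qed
  with False show ?thesis
    by (simp add: minimal_error_def E_def \<Lambda>_def)
qed

section \<open>Equality of the initial errors\<close>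

lemma norm_adjoint_eq_onorm_iff:
  fixes S :: "'a::{real_inner,complete_space} \<Rightarrow> 'b::real_inner"
  assumes bl: "bounded_linear S" and "S \<noteq> (\<lambda>f. 0)"
  shows "norm (adjoint S g) = onorm S \<and> norm g = 1 \<longleftrightarrow>
    (\<exists>\<eta>. g = (1 / onorm S) *\<^sub>R S \<eta> \<and> norm \<eta> = 1 \<and> adjoint S (S \<eta>) = (onorm S)\<^sup>2 *\<^sub>R \<eta>)"
    (is "?L \<longleftrightarrow> ?R")
proof -
  interpret S: bounded_linear S by fact
  define s where "s = onorm S"
  have s: "s > 0"
    using onorm_pos_lt[OF bl] assms(2) by (auto simp: s_def)
  show ?thesis
  proof
    assume ?L
    then have g: "norm (adjoint S g) = s" "norm g = 1" by (simp_all add: s_def)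
    \<comment> \<open>Here \<open>r = s\<close>, so the error term is zero and the estimate becomes
      an equality of vectors.\<close>
    have "(norm (S (adjoint S g) - s\<^sup>2 *\<^sub>R g))\<^sup>2 \<le> s\<^sup>2 * (s\<^sup>2 - s\<^sup>2)"
    proof (rule norm_diff_scaleR_square_le)
      show "norm (S (adjoint S g)) \<le> s * s"
        using onorm[OF bl, of "adjoint S g"] g by (simp add: s_def)
      show "S (adjoint S g) \<bullet> g = s\<^sup>2"
        by (simp add: adjoint_inner_right[OF bl, symmetric] dot_square_norm g)
    qed (use g s in auto)
    then have SSg: "S (adjoint S g) = s\<^sup>2 *\<^sub>R g" by simp
    define \<eta> where "\<eta> = (1 / s) *\<^sub>R adjoint S g"
    have S\<eta>: "S \<eta> = s *\<^sub>R g"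
      using s by (simp add: \<eta>_def S.scaleR SSg power2_eq_square)
    have "g = (1 / s) *\<^sub>R S \<eta>"
      using s by (simp add: S\<eta>)
    moreover have "norm \<eta> = 1"
      using s g by (simp add: \<eta>_def)
    moreover have "adjoint S (S \<eta>) = s\<^sup>2 *\<^sub>R \<eta>"
      using s by (simp add: S\<eta> adjoint_scaleR[OF bl]) (simp add: \<eta>_def power2_eq_square)
    ultimately show ?R unfolding s_def by (intro exI[of _ \<eta>] conjI)
  next
    assume ?R
    then obtain \<eta> where \<eta>: "g = (1 / s) *\<^sub>R S \<eta>" "norm \<eta> = 1" "adjoint S (S \<eta>) = s\<^sup>2 *\<^sub>R \<eta>"
      unfolding s_def by blast
    have "(norm (S \<eta>))\<^sup>2 = \<eta> \<bullet> adjoint S (S \<eta>)"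
      by (simp add: adjoint_inner_right[OF bl] dot_square_norm)
    also have "\<dots> = s\<^sup>2"
      by (simp add: \<eta> dot_square_norm)
    finally have "norm (S \<eta>) = s"
      using s by simp
    then have "norm g = 1"
      using s by (simp add: \<eta>(1))
    \<comment> \<open>The eigenvector equation gives
      \<open>adjoint S g = s *\<^sub>R \<eta>\<close>.\<close>
    moreover have "norm (adjoint S g) = s"
      using s \<eta>(2) by (simp add: \<eta>(1) adjoint_scaleR[OF bl] \<eta>(3) power2_eq_square)
    ultimately show ?L by (simp add: s_def)
  qed
qed

theorem theorem1:
  fixes D :: "(real ^ 'd) set"
    and ev :: "'f::{real_inner,complete_space} \<Rightarrow> real ^ 'd \<Rightarrow> real"
    and S :: "'f \<Rightarrow> 'g::{real_inner,complete_space}"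
    and lambda1 :: real
  assumes "rkhs D ev"
    and "compact_operator S"
    and "S \<noteq> (\<lambda>f. 0)"
    and "lambda1 = largest_eigenvalue (adjoint S \<circ> S)"
  shows "(\<forall>g. norm g = 1 \<longrightarrow>
            (\<forall>n. minimal_error (std_information D ev) n (dual_functional S g)
                 \<le> minimal_error (std_information D ev) n S)) \<and>
         (\<forall>g. (minimal_error (std_information D ev) 0 (dual_functional S g)
                 = minimal_error (std_information D ev) 0 S \<and> norm g = 1) \<longleftrightarrow>
              (\<exists>\<eta>. g = lambda1 powr (- 1 / 2) *\<^sub>R S \<eta> \<and> norm \<eta> = 1 \<and>
                   (adjoint S \<circ> S) \<eta> = lambda1 *\<^sub>R \<eta>))"
proof -
  have bl: "bounded_linear S"
    using assms(2) by (simp add: compact_operator_def)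
  then interpret S: bounded_linear S .
  \<comment> \<open>A non-zero \<open>S\<close> needs a non-zero \<open>f\<close>, and elements are
    determined by their values on \<open>D\<close>, so \<open>D\<close> cannot be empty.\<close>
  obtain f where "S f \<noteq> 0"
    using assms(3) by auto
  then have "f \<noteq> 0"
    by (auto simp: S.zero)
  then have "\<exists>t\<in>D. ev f t \<noteq> ev 0 t"
    using assms(1) unfolding rkhs_def by metis
  then have "D \<noteq> {}" by auto
  have pos: "onorm S > 0"
    using onorm_pos_lt[OF bl] assms(3) by auto
  have lambda1: "lambda1 = (onorm S)\<^sup>2"
    unfolding assms(4) by (rule largest_eigenvalue_adjoint_comp[OF assms(2,3)])
  have "lambda1 powr (- (1 / 2)) = inverse (lambda1 powr (1 / 2))"
    by (rule powr_minus)
  also have "lambda1 powr (1 / 2) = onorm S"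
    using pos by (simp add: lambda1 powr_half_sqrt)
  finally have root: "lambda1 powr (- 1 / 2) = 1 / onorm S"
    by (simp add: inverse_eq_divide)
  have zero: "minimal_error (std_information D ev) 0 S = onorm S"
    by (simp add: minimal_error_def)
  show ?thesis
  proof (intro conjI allI impI)
    fix g :: 'g and n
    assume "norm g = 1"
    then show "minimal_error (std_information D ev) n (dual_functional S g)
        \<le> minimal_error (std_information D ev) n S"
      by (rule minimal_error_dual_functional_le[OF assms(1) \<open>D \<noteq> {}\<close> bl])
  next
    fix g
    show "(minimal_error (std_information D ev) 0 (dual_functional S g)
          = minimal_error (std_information D ev) 0 S \<and> norm g = 1) \<longleftrightarrow>
        (\<exists>\<eta>. g = lambda1 powr (- 1 / 2) *\<^sub>R S \<eta> \<and> norm \<eta> = 1 \<and>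
             (adjoint S \<circ> S) \<eta> = lambda1 *\<^sub>R \<eta>)"
      unfolding minimal_error_zero_dual_functional zero root comp_apply
      unfolding lambda1 by (rule norm_adjoint_eq_onorm_iff[OF bl assms(3)])
  qed
qed

end
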